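(* Let $f_n, f:[0,1)\to\mathbb{R}$ ($n=1,2,\ldots$) be measurable functions. Suppose that $(f_n)$ converges statistically almost everywhere to $f$ and that there exists $g\in L^1(\lambda)$ such that, for every $n=1,2,\ldots$, $|f_n(x)|\le g(x)$ for $\lambda$-almost every $x\in[0,1)$. Then the real sequence $\left(\int f_n\,d\lambda\right)_n$ converges statistically to $\int f\,d\lambda$.
   Context: $\mathbb{N}$ is the set of positive integers. The measure space is $([0,1),\Sigma,\lambda)$, with $\Sigma$ the $\sigma$-algebra of Lebesgue measurable subsets of $[0,1)$ and $\lambda$ Lebesgue measure; integrals are over $[0,1)$. Density: for $A\subseteq\mathbb{N}$, $d(A)=\lim_{n\to\infty}\frac{|\{k\in A: k\le n\}|}{n}$, if this limit exists. Writing $d(A)=c$ means that the limit exists and equals $c$. A real sequence $(a_n)$ converges statistically to $a\in\mathbb{R}$ if for every $\varepsilon>0$, $d(\{n\in\mathbb{N}:|a_n-a|\ge\varepsilon\})=0$. $(f_n)$ converges statistically almost everywhere to $f$ if for $\lambda$-almost every $x\in[0,1)$ the real sequence $(f_n(x))_n$ converges statistically to $f(x)$. *)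

theory Defs
  imports "HOL-Analysis.Analysis"
begin

text \<open>
  The positive integers are rendered as the elements \<open>n \<ge> 1\<close> of \<^typ>\<open>nat\<close>. Sequences are functions
  on \<^typ>\<open>nat\<close> whose value at \<open>0\<close> is never used.
\<close>

definition has_density :: "nat set \<Rightarrow> real \<Rightarrow> bool" where
  "has_density A c \<longleftrightarrow>
     (\<lambda>n. real (card {k \<in> A. 1 \<le> k \<and> k \<le> n}) / real n) \<longlonglongrightarrow> c"

definition stat_converges :: "(nat \<Rightarrow> real) \<Rightarrow> real \<Rightarrow> bool" where
  "stat_converges a l \<longleftrightarrow>
     (\<forall>\<epsilon>>0. has_density {n. 1 \<le> n \<and> \<bar>a n - l\<bar> \<ge> \<epsilon>} 0)"

definition stat_converges_AE ::
  "'a measure \<Rightarrow> (nat \<Rightarrow> 'a \<Rightarrow> real) \<Rightarrow> ('a \<Rightarrow> real) \<Rightarrow> bool" where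
  "stat_converges_AE M f g \<longleftrightarrow> (AE x in M. stat_converges (\<lambda>n. f n x) (g x))"

abbreviation leb01 :: "real measure" where
  "leb01 \<equiv> lebesgue_on {0..<1}"

end

theory Submission
  imports Defs
begin

text \<open>
  The dominated convergence theorem is about ordinary limits, and statistical convergence at
  almost every point does not provide a single set of indices, common to those points, along which
  ordinary convergence holds. Cesaro means get around this: for a bounded sequence \<open>a\<close>,
  statistical convergence to \<open>l\<close> is the same as ordinary convergence to \<open>0\<close> of the means
  \<open>(\<Sum>k=1..n. \<bar>a k - l\<bar>) / n\<close> (strong Cesaro convergence).

  At almost every \<open>x\<close> the sequence \<open>f n x\<close> is bounded by \<open>g x\<close>, so the means of
  \<open>\<bar>f k x - f_lim x\<bar>\<close> tend to \<open>0\<close> (\<open>stat_converges_bounded_imp_cesaro\<close>). The limit inherits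
  the bound (\<open>stat_converges_abs_le\<close>), so these means are dominated by \<open>2 * g x\<close>, and the usual
  dominated convergence theorem sends their integrals to \<open>0\<close>. By linearity these integrals are the
  means of \<open>\<integral> \<bar>f k - f_lim\<bar>\<close>, which majorise the means of \<open>\<bar>\<integral> f k - \<integral> f_lim\<bar>\<close>; finally strong
  Cesaro convergence of the integrals gives their statistical convergence
  (\<open>cesaro_imp_stat_converges\<close>).
\<close>

text \<open>
  If \<open>l\<close> were outside \<open>{-c..c}\<close>, all terms of the sequence would keep a positive distance from
  it, and the set of all positive integers has density \<open>1\<close>, not \<open>0\<close>.
\<close>

lemma stat_converges_abs_le:
  assumes conv: "stat_converges a l" and bnd: "\<And>n. 1 \<le> n \<Longrightarrow> \<bar>a n\<bar> \<le> c"
  shows "\<bar>l\<bar> \<le> c"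
proof (rule ccontr)
  assume "\<not> \<bar>l\<bar> \<le> c"
  then have pos: "0 < \<bar>l\<bar> - c" by simp
  have far: "\<bar>a n - l\<bar> \<ge> \<bar>l\<bar> - c" if "1 \<le> n" for n
    using bnd[OF that] by linarith
  have "(\<lambda>n. real (card {k \<in> {n. 1 \<le> n \<and> \<bar>a n - l\<bar> \<ge> \<bar>l\<bar> - c}. 1 \<le> k \<and> k \<le> n}) / real n)
      \<longlonglongrightarrow> 0"
    using conv pos unfolding stat_converges_def has_density_def by blast
  moreover have "{k \<in> {n. 1 \<le> n \<and> \<bar>a n - l\<bar> \<ge> \<bar>l\<bar> - c}. 1 \<le> k \<and> k \<le> n} = {1..n}" for n
    using far by auto
  ultimately have "(\<lambda>n. real n / real n) \<longlonglongrightarrow> 0" by simp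
  moreover have "(\<lambda>n. real n / real n) \<longlonglongrightarrow> 1"
    by (rule tendsto_eventually) (auto intro!: eventually_sequentiallyI[of 1])
  ultimately show False using LIMSEQ_unique by fastforce
qed

text \<open>
  Indices at which \<open>a\<close> is \<open>\<epsilon>\<close>-close to \<open>l\<close> contribute at most \<open>\<epsilon>\<close> to the mean; each of the
  others contributes at most \<open>c / n\<close>, and they have density \<open>0\<close>. Without a bound such as \<open>c\<close> the
  implication fails, as a few huge terms can dominate the mean.
\<close>

lemma stat_converges_bounded_imp_cesaro:
  assumes conv: "stat_converges a l" and bnd: "\<And>n. 1 \<le> n \<Longrightarrow> \<bar>a n - l\<bar> \<le> c"
  shows "(\<lambda>n. (\<Sum>k=1..n. \<bar>a k - l\<bar>) / real n) \<longlonglongrightarrow> 0"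
proof (rule LIMSEQ_I)
  fix r :: real
  assume r: "0 < r"
  define B where "B n = {k \<in> {n. 1 \<le> n \<and> \<bar>a n - l\<bar> \<ge> r / 2}. 1 \<le> k \<and> k \<le> n}" for n
  have "(\<lambda>n. real (card (B n)) / real n) \<longlonglongrightarrow> 0"
    using conv r unfolding stat_converges_def has_density_def B_def
    by (meson half_gt_zero)
  then have "(\<lambda>n. c * (real (card (B n)) / real n)) \<longlonglongrightarrow> 0"
    by (rule tendsto_mult_right_zero)
  then obtain N where N: "\<And>n. n \<ge> N \<Longrightarrow> \<bar>c * (real (card (B n)) / real n)\<bar> < r / 2"
    using LIMSEQ_D[of _ 0 "r / 2"] r by fastforce
  have "norm ((\<Sum>k=1..n. \<bar>a k - l\<bar>) / real n - 0) < r" if n: "N \<le> n" "1 \<le> n" for n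
  proof -
    have "(\<Sum>k=1..n. \<bar>a k - l\<bar>) \<le> (\<Sum>k=1..n. r / 2 + (if k \<in> B n then c else 0))"
    proof (rule sum_mono)
      fix k assume k: "k \<in> {1..n}"
      show "\<bar>a k - l\<bar> \<le> r / 2 + (if k \<in> B n then c else 0)"
        using bnd[of k] k r unfolding B_def by auto
    qed
    also have "\<dots> = real n * (r / 2) + (\<Sum>k\<in>{1..n} \<inter> B n. c)"
      by (simp only: sum.distrib sum.inter_restrict[OF finite_atLeastAtMost]) simp
    also have "{1..n} \<inter> B n = B n" unfolding B_def by auto
    finally have "(\<Sum>k=1..n. \<bar>a k - l\<bar>) / real n \<le> r / 2 + c * (real (card (B n)) / real n)"
      using n by (simp add: field_simps)
    also have "\<dots> < r" using N[OF n(1)] by linarith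
    finally show ?thesis by (simp add: sum_nonneg)
  qed
  then show "\<exists>no. \<forall>n\<ge>no. norm ((\<Sum>k=1..n. \<bar>a k - l\<bar>) / real n - 0) < r"
    by (metis max.bounded_iff)
qed

text \<open>
  This is Markov's inequality for the counting measure on \<open>{1..n}\<close>: an index with
  \<open>\<bar>a k - l\<bar> \<ge> \<epsilon>\<close> contributes at least \<open>\<epsilon>\<close> to the sum.
\<close>

lemma cesaro_imp_stat_converges:
  assumes "(\<lambda>n. (\<Sum>k=1..n. \<bar>a k - l\<bar>) / real n) \<longlonglongrightarrow> 0"
  shows "stat_converges a l"
  unfolding stat_converges_def has_density_def
proof (intro allI impI)
  fix e :: real
  assume e: "0 < e"
  define B where "B n = {k \<in> {n. 1 \<le> n \<and> \<bar>a n - l\<bar> \<ge> e}. 1 \<le> k \<and> k \<le> n}" for n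
  have le: "real (card (B n)) / real n \<le> (\<Sum>k=1..n. \<bar>a k - l\<bar>) / real n / e" for n
  proof -
    have "real (card (B n)) * e = (\<Sum>k\<in>B n. e)" by simp
    also have "\<dots> \<le> (\<Sum>k\<in>B n. \<bar>a k - l\<bar>)"
      by (rule sum_mono) (simp add: B_def)
    also have "\<dots> \<le> (\<Sum>k=1..n. \<bar>a k - l\<bar>)"
      by (rule sum_mono2) (auto simp: B_def)
    finally have "real (card (B n)) \<le> (\<Sum>k=1..n. \<bar>a k - l\<bar>) / e"
      using e by (simp add: field_simps)
    then have "real (card (B n)) / real n \<le> (\<Sum>k=1..n. \<bar>a k - l\<bar>) / e / real n"
      by (rule divide_right_mono) simp
    then show ?thesis by (simp add: mult.commute)
  qed
  have lim: "(\<lambda>n. (\<Sum>k=1..n. \<bar>a k - l\<bar>) / real n / e) \<longlonglongrightarrow> 0"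
    using tendsto_divide_zero[OF assms] .
  have "(\<lambda>n. real (card (B n)) / real n) \<longlonglongrightarrow> 0"
    by (rule tendsto_sandwich[OF always_eventually always_eventually[OF allI, OF le]
          tendsto_const lim]) simp
  then show "(\<lambda>n. real (card {k \<in> {n. 1 \<le> n \<and> \<bar>a n - l\<bar> \<ge> e}. 1 \<le> k \<and> k \<le> n}) / real n)
      \<longlonglongrightarrow> 0"
    unfolding B_def .
qed

text \<open>
  Dominated convergence is applied to the averages \<open>C n\<close> of \<open>\<bar>f k - f_lim\<bar>\<close>. The absolute value
  sits inside the average because signed differences with different \<open>k\<close> could cancel; averages of
  them would say nothing about the individual integrals.
\<close>

theorem stat_dominated_convergence:
  fixes f :: "nat \<Rightarrow> 'a \<Rightarrow> real" and f_lim g :: "'a \<Rightarrow> real"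
  assumes meas: "\<And>n. 1 \<le> n \<Longrightarrow> f n \<in> borel_measurable M"
    and meas_lim: "f_lim \<in> borel_measurable M"
    and conv: "stat_converges_AE M f f_lim"
    and int_g: "integrable M g"
    and dom: "\<And>n. 1 \<le> n \<Longrightarrow> AE x in M. \<bar>f n x\<bar> \<le> g x"
  shows stat_dominated_convergence_integrable: "\<And>n. 1 \<le> n \<Longrightarrow> integrable M (f n)"
    and stat_dominated_convergence_integrable_lim: "integrable M f_lim"
    and stat_dominated_convergence_integral:
      "stat_converges (\<lambda>n. integral\<^sup>L M (f n)) (integral\<^sup>L M f_lim)"
proof -
  show int_f: "integrable M (f n)" if "1 \<le> n" for n
    by (rule Bochner_Integration.integrable_bound[OF int_g meas[OF that]])
      (use dom[OF that] in auto)
  \<comment> \<open>Countably many almost-everywhere bounds hold simultaneously almost everywhere.\<close>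
  have "AE x in M. \<forall>n. 1 \<le> n \<longrightarrow> \<bar>f n x\<bar> \<le> g x"
    using dom by (subst AE_all_countable) auto
  with conv[unfolded stat_converges_AE_def]
  have good: "AE x in M. stat_converges (\<lambda>n. f n x) (f_lim x) \<and>
      (\<forall>n. 1 \<le> n \<longrightarrow> \<bar>f n x\<bar> \<le> g x) \<and> \<bar>f_lim x\<bar> \<le> g x"
    by eventually_elim (auto intro: stat_converges_abs_le)
  show int_lim: "integrable M f_lim"
    by (rule Bochner_Integration.integrable_bound[OF int_g meas_lim]) (use good in auto)
  define C where "C n x = (\<Sum>k=1..n. \<bar>f k x - f_lim x\<bar>) / real n" for n x
  have "(\<lambda>n. integral\<^sup>L M (C n)) \<longlonglongrightarrow> integral\<^sup>L M (\<lambda>_. 0)"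
  proof (rule integral_dominated_convergence[where w = "\<lambda>x. 2 * g x"])
    show "integrable M (\<lambda>x. 2 * g x)" using int_g by simp
    show "C n \<in> borel_measurable M" for n
      unfolding C_def using meas meas_lim
      by (intro borel_measurable_divide borel_measurable_sum borel_measurable_abs
          borel_measurable_diff) auto
    show "AE x in M. (\<lambda>n. C n x) \<longlonglongrightarrow> 0"
      using good
    proof eventually_elim
      case (elim x)
      have "\<bar>f k x - f_lim x\<bar> \<le> 2 * g x" if "1 \<le> k" for k
      proof -
        have "\<bar>f k x\<bar> \<le> g x" "\<bar>f_lim x\<bar> \<le> g x" using elim that by auto
        then show ?thesis by linarith
      qed
      moreover have "stat_converges (\<lambda>n. f n x) (f_lim x)" using elim by simp
      ultimately show ?case
        unfolding C_def by (rule stat_converges_bounded_imp_cesaro[rotated])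
    qed
    show "AE x in M. norm (C n x) \<le> 2 * g x" for n
      using good
    proof eventually_elim
      case (elim x)
      have bnd: "\<bar>f k x - f_lim x\<bar> \<le> 2 * g x" if "1 \<le> k" for k
      proof -
        have "\<bar>f k x\<bar> \<le> g x" "\<bar>f_lim x\<bar> \<le> g x" using elim that by auto
        then show ?thesis by linarith
      qed
      have "(\<Sum>k=1..n. \<bar>f k x - f_lim x\<bar>) \<le> (\<Sum>k=1..n. 2 * g x)"
        by (rule sum_mono) (use bnd in auto)
      then have "(\<Sum>k=1..n. \<bar>f k x - f_lim x\<bar>) \<le> real n * (2 * g x)" by simp
      moreover have "0 \<le> g x" using elim by linarith
      ultimately show ?case
        by (cases "n = 0") (auto simp: C_def sum_nonneg field_simps)
    qed
  qed simp
  then have lim: "(\<lambda>n. integral\<^sup>L M (C n)) \<longlonglongrightarrow> 0" by simp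
  have le: "(\<Sum>k=1..n. \<bar>integral\<^sup>L M (f k) - integral\<^sup>L M f_lim\<bar>) / real n \<le> integral\<^sup>L M (C n)"
    for n
  proof -
    have int_diff: "integrable M (\<lambda>x. \<bar>f k x - f_lim x\<bar>)" if "1 \<le> k" for k
      using int_f[OF that] int_lim by simp
    have "(\<Sum>k=1..n. \<bar>integral\<^sup>L M (f k) - integral\<^sup>L M f_lim\<bar>)
        \<le> (\<Sum>k=1..n. \<integral>x. \<bar>f k x - f_lim x\<bar> \<partial>M)"
    proof (rule sum_mono)
      fix k assume "k \<in> {1..n}"
      then have "integral\<^sup>L M (f k) - integral\<^sup>L M f_lim = (\<integral>x. f k x - f_lim x \<partial>M)"
        using int_f[of k] int_lim by simp
      then show "\<bar>integral\<^sup>L M (f k) - integral\<^sup>L M f_lim\<bar> \<le> (\<integral>x. \<bar>f k x - f_lim x\<bar> \<partial>M)"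
        by (simp only: integral_abs_bound)
    qed
    also have "\<dots> = (\<integral>x. (\<Sum>k=1..n. \<bar>f k x - f_lim x\<bar>) \<partial>M)"
      by (rule Bochner_Integration.integral_sum[symmetric]) (use int_diff in auto)
    finally show ?thesis
      unfolding C_def by (simp add: divide_right_mono)
  qed
  show "stat_converges (\<lambda>n. integral\<^sup>L M (f n)) (integral\<^sup>L M f_lim)"
    by (rule cesaro_imp_stat_converges,
        rule tendsto_sandwich[OF always_eventually always_eventually[OF allI, OF le]
          tendsto_const lim]) (simp add: sum_nonneg)
qed

theorem proposition3p7:
  fixes f :: "nat \<Rightarrow> real \<Rightarrow> real" and f_lim g :: "real \<Rightarrow> real"
  assumes "\<And>n. 1 \<le> n \<Longrightarrow> f n \<in> borel_measurable leb01"
    and "f_lim \<in> borel_measurable leb01"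
    and "stat_converges_AE leb01 f f_lim"
    and "integrable leb01 g"
    and "\<And>n. 1 \<le> n \<Longrightarrow> AE x in leb01. \<bar>f n x\<bar> \<le> g x"
  shows "(\<forall>n\<ge>1. integrable leb01 (f n)) \<and> integrable leb01 f_lim \<and>
    stat_converges (\<lambda>n. integral\<^sup>L leb01 (f n)) (integral\<^sup>L leb01 f_lim)"
  using stat_dominated_convergence[OF assms] by blast

end
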